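(* Let $D$ and $E$ be subcategories (not assumed full) of a category $C$, with $D$ coreflective and $E$ reflective in $C$. Let $F:C\to E$ be the reflector, with unit $\eta_x:x\to Fx$ ($x\in\operatorname{Obj}C$), and let $G:C\to D$ be the coreflector, with counit $\psi_x:Gx\to x$ ($x\in\operatorname{Obj}C$). Assume: (i) for all $z,x\in\operatorname{Obj}D$, $w\in\operatorname{Obj}E$, $f\in C(z,Fx)$ and $g\in C(x,w)$, there exist unique $h\in D(z,x)$ and $k\in E(Fx,w)$ such that $\eta_x\circ h=f$ and $k\circ\eta_x=g$; and (ii) for all $z\in\operatorname{Obj}D$, $y,w\in\operatorname{Obj}E$, $f\in C(z,y)$ and $g\in C(Gy,w)$, there exist unique $h\in D(z,Gy)$ and $k\in E(y,w)$ such that $\psi_y\circ h=f$ and $k\circ\psi_y=g$. Then the restrictions $F|_D:D\to E$ and $G|_E:E\to D$ form a category equivalence, i.e. they are quasi-inverse to each other: $FG\cong\mathrm{id}_E$ and $GF\cong\mathrm{id}_D$.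
   Context: $C(x,y)$ denotes the set of arrows from $x$ to $y$ in $C$. $E$ is reflective in $C$ if the inclusion functor $E\hookrightarrow C$ has a left adjoint $F:C\to E$ (the reflector); with unit $\eta$, this means that for each $x\in\operatorname{Obj}C$, $y\in\operatorname{Obj}E$ and $f\in C(x,y)$ there is a unique $g\in E(Fx,y)$ with $g\circ\eta_x=f$. $D$ is coreflective in $C$ if the inclusion functor $D\hookrightarrow C$ has a right adjoint $G:C\to D$ (the coreflector); with counit $\psi$, this means that for each $x\in\operatorname{Obj}C$, $y\in\operatorname{Obj}D$ and $f\in C(y,x)$ there is a unique $g\in D(y,Gx)$ with $\psi_x\circ g=f$. The components $\eta_x$ and $\psi_x$ are arrows of $C$. The symbol $\cong$ between functors denotes natural isomorphism. *)

theory Defs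
  imports Main
begin

text \<open>
  A category is a record over a type of objects and a type of arrows, with explicit carriers.
  Composition is a total function that is only constrained on composable pairs;
  \<open>g \<odot>\<^bsub>C\<^esub> f\<close> is \<open>g\<close> after \<open>f\<close>.
\<close>

record ('o, 'a) cat =
  Obj :: "'o set"
  Arr :: "'a set"
  Dom :: "'a \<Rightarrow> 'o"
  Cod :: "'a \<Rightarrow> 'o"
  Ide :: "'o \<Rightarrow> 'a"
  Comp :: "'a \<Rightarrow> 'a \<Rightarrow> 'a"  (infixl "\<odot>\<index>" 70)

definition Hom :: "('o, 'a) cat \<Rightarrow> 'o \<Rightarrow> 'o \<Rightarrow> 'a set"
  where "Hom C x y = {f \<in> Arr C. Dom C f = x \<and> Cod C f = y}"

locale category =
  fixes C :: "('o, 'a) cat" (structure)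
  assumes Dom_in_Obj: "f \<in> Arr C \<Longrightarrow> Dom C f \<in> Obj C"
    and Cod_in_Obj: "f \<in> Arr C \<Longrightarrow> Cod C f \<in> Obj C"
    and Ide_in_Hom: "x \<in> Obj C \<Longrightarrow> Ide C x \<in> Hom C x x"
    and Comp_in_Hom: "\<lbrakk>f \<in> Hom C x y; g \<in> Hom C y z\<rbrakk> \<Longrightarrow> g \<odot> f \<in> Hom C x z"
    and Comp_Ide_right: "f \<in> Hom C x y \<Longrightarrow> f \<odot> Ide C x = f"
    and Comp_Ide_left: "f \<in> Hom C x y \<Longrightarrow> Ide C y \<odot> f = f"
    and Comp_assoc: "\<lbrakk>f \<in> Hom C w x; g \<in> Hom C x y; h \<in> Hom C y z\<rbrakk>
      \<Longrightarrow> (h \<odot> g) \<odot> f = h \<odot> (g \<odot> f)"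

text \<open>Subcategories are not assumed to be full.\<close>

locale subcategory = sub: category D + amb: category C
  for D :: "('o, 'a) cat" and C :: "('o, 'a) cat" +
  assumes Obj_subset: "Obj D \<subseteq> Obj C"
    and Hom_subset: "Hom D x y \<subseteq> Hom C x y"
    and Ide_eq: "x \<in> Obj D \<Longrightarrow> Ide D x = Ide C x"
    and Comp_eq: "\<lbrakk>f \<in> Hom D x y; g \<in> Hom D y z\<rbrakk> \<Longrightarrow> g \<odot>\<^bsub>D\<^esub> f = g \<odot>\<^bsub>C\<^esub> f"

text \<open>
  A functor is given by its object map and its arrow map; its source and target categories are
  parameters of the locale \<open>is_functor\<close>. Values outside the source category are irrelevant.
\<close>

record ('o, 'a, 'p, 'b) func =
  omap :: "'o \<Rightarrow> 'p"
  amap :: "'a \<Rightarrow> 'b"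

locale is_functor = src: category A + tgt: category B
  for A :: "('o, 'a) cat" and B :: "('p, 'b) cat" and F :: "('o, 'a, 'p, 'b) func" +
  assumes omap_in_Obj: "x \<in> Obj A \<Longrightarrow> omap F x \<in> Obj B"
    and amap_in_Hom: "f \<in> Hom A x y \<Longrightarrow> amap F f \<in> Hom B (omap F x) (omap F y)"
    and amap_Ide: "x \<in> Obj A \<Longrightarrow> amap F (Ide A x) = Ide B (omap F x)"
    and amap_Comp: "\<lbrakk>f \<in> Hom A x y; g \<in> Hom A y z\<rbrakk>
      \<Longrightarrow> amap F (g \<odot>\<^bsub>A\<^esub> f) = amap F g \<odot>\<^bsub>B\<^esub> amap F f"

text \<open>
  The identity functor. The same maps also give the inclusion functor of any subcategory, which
  is why the latter needs no category argument.
\<close>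

definition id_func :: "('o, 'a, 'o, 'a) func"
  where "id_func = \<lparr>omap = (\<lambda>x. x), amap = (\<lambda>f. f)\<rparr>"

abbreviation incl :: "('o, 'a, 'o, 'a) func"
  where "incl \<equiv> id_func"

definition comp_func ::
    "('p, 'b, 'q, 'c) func \<Rightarrow> ('o, 'a, 'p, 'b) func \<Rightarrow> ('o, 'a, 'q, 'c) func"
    (infixl "\<circ>\<^sub>F" 70)
  where "G \<circ>\<^sub>F F = \<lparr>omap = (\<lambda>x. omap G (omap F x)), amap = (\<lambda>f. amap G (amap F f))\<rparr>"

locale nat_trans = dom: is_functor A B F + cod: is_functor A B G
  for A :: "('o, 'a) cat" and B :: "('p, 'b) cat"
    and F :: "('o, 'a, 'p, 'b) func" and G :: "('o, 'a, 'p, 'b) func"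
    and \<tau> :: "'o \<Rightarrow> 'b" +
  assumes component_in_Hom: "x \<in> Obj A \<Longrightarrow> \<tau> x \<in> Hom B (omap F x) (omap G x)"
    and naturality: "f \<in> Hom A x y \<Longrightarrow> \<tau> y \<odot>\<^bsub>B\<^esub> amap F f = amap G f \<odot>\<^bsub>B\<^esub> \<tau> x"

definition iso_arrow :: "('o, 'a) cat \<Rightarrow> 'o \<Rightarrow> 'o \<Rightarrow> 'a \<Rightarrow> bool"
  where "iso_arrow C x y f \<longleftrightarrow> f \<in> Hom C x y \<and>
    (\<exists>g \<in> Hom C y x. g \<odot>\<^bsub>C\<^esub> f = Ide C x \<and> f \<odot>\<^bsub>C\<^esub> g = Ide C y)"

definition nat_isomorphic ::
    "('o, 'a) cat \<Rightarrow> ('p, 'b) cat \<Rightarrow> ('o, 'a, 'p, 'b) func \<Rightarrow> ('o, 'a, 'p, 'b) func \<Rightarrow> bool"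
  where "nat_isomorphic A B F G \<longleftrightarrow>
    (\<exists>\<tau>. nat_trans A B F G \<tau> \<and> (\<forall>x \<in> Obj A. iso_arrow B (omap F x) (omap G x) (\<tau> x)))"

definition quasi_inverse ::
    "('o, 'a) cat \<Rightarrow> ('p, 'b) cat \<Rightarrow> ('o, 'a, 'p, 'b) func \<Rightarrow> ('p, 'b, 'o, 'a) func \<Rightarrow> bool"
  where "quasi_inverse A B F G \<longleftrightarrow> is_functor A B F \<and> is_functor B A G \<and>
    nat_isomorphic B B (F \<circ>\<^sub>F G) id_func \<and> nat_isomorphic A A (G \<circ>\<^sub>F F) id_func"

text \<open>
  \<open>L : A \<rightarrow> B\<close> is left adjoint to \<open>R : B \<rightarrow> A\<close>, with the adjunction given either by its
  unit \<open>\<eta> : id \<rightarrow> RL\<close> or by its counit \<open>\<epsilon> : LR \<rightarrow> id\<close>.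
\<close>

definition adjoint_with_unit ::
    "('o, 'a) cat \<Rightarrow> ('p, 'b) cat \<Rightarrow> ('o, 'a, 'p, 'b) func \<Rightarrow> ('p, 'b, 'o, 'a) func
      \<Rightarrow> ('o \<Rightarrow> 'a) \<Rightarrow> bool"
  where "adjoint_with_unit A B L R \<eta> \<longleftrightarrow>
    is_functor A B L \<and> is_functor B A R \<and> nat_trans A A id_func (R \<circ>\<^sub>F L) \<eta> \<and>
    (\<forall>x \<in> Obj A. \<forall>y \<in> Obj B. \<forall>f \<in> Hom A x (omap R y).
      \<exists>!g. g \<in> Hom B (omap L x) y \<and> amap R g \<odot>\<^bsub>A\<^esub> \<eta> x = f)"

definition adjoint_with_counit ::
    "('o, 'a) cat \<Rightarrow> ('p, 'b) cat \<Rightarrow> ('o, 'a, 'p, 'b) func \<Rightarrow> ('p, 'b, 'o, 'a) func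
      \<Rightarrow> ('p \<Rightarrow> 'b) \<Rightarrow> bool"
  where "adjoint_with_counit A B L R \<epsilon> \<longleftrightarrow>
    is_functor A B L \<and> is_functor B A R \<and> nat_trans B B (L \<circ>\<^sub>F R) id_func \<epsilon> \<and>
    (\<forall>x \<in> Obj B. \<forall>y \<in> Obj A. \<forall>f \<in> Hom B (omap L y) x.
      \<exists>!g. g \<in> Hom A y (omap R x) \<and> \<epsilon> x \<odot>\<^bsub>B\<^esub> amap L g = f)"

definition is_reflector ::
    "('o, 'a) cat \<Rightarrow> ('o, 'a) cat \<Rightarrow> ('o, 'a, 'o, 'a) func \<Rightarrow> ('o \<Rightarrow> 'a) \<Rightarrow> bool"
  where "is_reflector C E F \<eta> \<longleftrightarrow> adjoint_with_unit C E F incl \<eta>"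

definition is_coreflector ::
    "('o, 'a) cat \<Rightarrow> ('o, 'a) cat \<Rightarrow> ('o, 'a, 'o, 'a) func \<Rightarrow> ('o \<Rightarrow> 'a) \<Rightarrow> bool"
  where "is_coreflector C D G \<psi> \<longleftrightarrow> adjoint_with_counit D C incl G \<psi>"

end

theory Submission
  imports Defs
begin

text \<open>
  The universal properties of \<open>\<psi>\<^sub>y\<close> given by (ii) and of \<open>\<eta>\<close> at \<open>G y\<close> produce arrows
  \<open>m : y \<rightarrow> F G y\<close> and \<open>k : F G y \<rightarrow> y\<close> of \<open>E\<close> with \<open>m \<circ> \<psi>\<^sub>y = \<eta>\<close> and \<open>k \<circ> \<eta> = \<psi>\<^sub>y\<close>;
  uniqueness makes them mutually inverse, and \<open>k\<close> natural in \<open>y\<close>. Dually, (i) and the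
  universal property of \<open>\<psi>\<close> at \<open>F x\<close> give an isomorphism \<open>n : G F x \<rightarrow> x\<close> of \<open>D\<close> with
  \<open>\<eta>\<^sub>x \<circ> n = \<psi>\<close>.
\<close>

lemma omap_id_func [simp]: "omap id_func x = x"
  and amap_id_func [simp]: "amap id_func f = f"
  by (simp_all add: id_func_def)

lemma omap_comp_func [simp]: "omap (G \<circ>\<^sub>F F) x = omap G (omap F x)"
  and amap_comp_func [simp]: "amap (G \<circ>\<^sub>F F) f = amap G (amap F f)"
  by (simp_all add: comp_func_def)

lemma HomD:
  assumes "category C" and "f \<in> Hom C x y"
  shows "x \<in> Obj C" and "y \<in> Obj C"
  using assms category.Dom_in_Obj category.Cod_in_Obj by (force simp: Hom_def)+

lemma is_functor_comp:
  assumes "is_functor A B F" and "is_functor B C G"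
  shows "is_functor A C (G \<circ>\<^sub>F F)"
proof -
  interpret F: is_functor A B F by fact
  interpret G: is_functor B C G by fact
  show ?thesis
    by unfold_locales
      (auto simp: F.omap_in_Obj G.omap_in_Obj F.amap_Ide G.amap_Ide F.amap_Comp
        intro: F.amap_in_Hom G.amap_in_Hom G.amap_Comp)
qed

lemma is_functor_id_func: "category A \<Longrightarrow> is_functor A A id_func"
  by (simp add: is_functor_def is_functor_axioms_def)

lemma nat_isomorphicI:
  assumes "is_functor A B F" and "is_functor A B G"
    and "\<And>x. x \<in> Obj A \<Longrightarrow> iso_arrow B (omap F x) (omap G x) (\<tau> x)"
    and "\<And>f x y. f \<in> Hom A x y \<Longrightarrow> \<tau> y \<odot>\<^bsub>B\<^esub> amap F f = amap G f \<odot>\<^bsub>B\<^esub> \<tau> x"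
  shows "nat_isomorphic A B F G"
  using assms unfolding nat_isomorphic_def nat_trans_def nat_trans_axioms_def iso_arrow_def
  by blast

theorem proposition2p1:
  fixes C D E :: "('o, 'a) cat"
    and F G :: "('o, 'a, 'o, 'a) func"
    and \<eta> \<psi> :: "'o \<Rightarrow> 'a"
  assumes "category C" and "subcategory D C" and "subcategory E C"
    and "is_reflector C E F \<eta>"
    and "is_coreflector C D G \<psi>"
    and i: "\<And>z x w f g. \<lbrakk>z \<in> Obj D; x \<in> Obj D; w \<in> Obj E;
        f \<in> Hom C z (omap F x); g \<in> Hom C x w\<rbrakk> \<Longrightarrow>
      (\<exists>!h. h \<in> Hom D z x \<and> \<eta> x \<odot>\<^bsub>C\<^esub> h = f) \<and>
      (\<exists>!k. k \<in> Hom E (omap F x) w \<and> k \<odot>\<^bsub>C\<^esub> \<eta> x = g)"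
    and ii: "\<And>z y w f g. \<lbrakk>z \<in> Obj D; y \<in> Obj E; w \<in> Obj E;
        f \<in> Hom C z y; g \<in> Hom C (omap G y) w\<rbrakk> \<Longrightarrow>
      (\<exists>!h. h \<in> Hom D z (omap G y) \<and> \<psi> y \<odot>\<^bsub>C\<^esub> h = f) \<and>
      (\<exists>!k. k \<in> Hom E y w \<and> k \<odot>\<^bsub>C\<^esub> \<psi> y = g)"
  shows "quasi_inverse D E (F \<circ>\<^sub>F incl) (G \<circ>\<^sub>F incl)"
proof -
  interpret C: category C by fact
  interpret D: subcategory D C by fact
  interpret E: subcategory E C by fact
  have F: "is_functor C E F" and inclE: "is_functor E C incl"
    and \<eta>: "nat_trans C C id_func (incl \<circ>\<^sub>F F) \<eta>"
    \<comment> \<open>The inclusion acts as the identity on arrows, so simplification erases it. The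
      universal property then compares composites in \<open>C\<close>, the category in which \<eta>
      lives.\<close>
    and reflect: "\<And>x y f. \<lbrakk>x \<in> Obj C; y \<in> Obj E; f \<in> Hom C x y\<rbrakk> \<Longrightarrow>
      \<exists>!g. g \<in> Hom E (omap F x) y \<and> g \<odot>\<^bsub>C\<^esub> \<eta> x = f"
    using \<open>is_reflector C E F \<eta>\<close> by (auto simp: is_reflector_def adjoint_with_unit_def)
  have G: "is_functor C D G" and inclD: "is_functor D C incl"
    and \<psi>: "nat_trans C C (incl \<circ>\<^sub>F G) id_func \<psi>"
    and coreflect: "\<And>x y f. \<lbrakk>x \<in> Obj C; y \<in> Obj D; f \<in> Hom C y x\<rbrakk> \<Longrightarrow>
      \<exists>!g. g \<in> Hom D y (omap G x) \<and> \<psi> x \<odot>\<^bsub>C\<^esub> g = f"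
    using \<open>is_coreflector C D G \<psi>\<close> by (auto simp: is_coreflector_def adjoint_with_counit_def)
  interpret F: is_functor C E F by (rule F)
  interpret G: is_functor C D G by (rule G)
  have objD: "x \<in> Obj C" if "x \<in> Obj D" for x using that D.Obj_subset by blast
  have objE: "x \<in> Obj C" if "x \<in> Obj E" for x using that E.Obj_subset by blast
  have homD: "f \<in> Hom C x y" if "f \<in> Hom D x y" for f x y using that D.Hom_subset by blast
  have homE: "f \<in> Hom C x y" if "f \<in> Hom E x y" for f x y using that E.Hom_subset by blast
  have \<eta>_hom: "\<eta> x \<in> Hom C x (omap F x)" if "x \<in> Obj C" for x
    using nat_trans.component_in_Hom[OF \<eta> that] by simp
  have \<psi>_hom: "\<psi> x \<in> Hom C (omap G x) x" if "x \<in> Obj C" for x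
    using nat_trans.component_in_Hom[OF \<psi> that] by simp
  have \<eta>_nat: "\<eta> y \<odot>\<^bsub>C\<^esub> f = amap F f \<odot>\<^bsub>C\<^esub> \<eta> x" if "f \<in> Hom C x y" for f x y
    using nat_trans.naturality[OF \<eta> that] by simp
  have \<psi>_nat: "\<psi> y \<odot>\<^bsub>C\<^esub> amap G f = f \<odot>\<^bsub>C\<^esub> \<psi> x" if "f \<in> Hom C x y" for f x y
    using nat_trans.naturality[OF \<psi> that] by simp
  \<comment> \<open>The first half of (i). Its premises also ask for some \<open>w\<close> and
    \<open>g\<close>; the choice \<open>w = omap F x\<close>, \<open>g = \<eta> x\<close> is always
    available.\<close>
  have lift: "\<exists>!h. h \<in> Hom D z x \<and> \<eta> x \<odot>\<^bsub>C\<^esub> h = f"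
    if "z \<in> Obj D" "x \<in> Obj D" "f \<in> Hom C z (omap F x)" for z x f
    using i[OF that(1,2) _ that(3) \<eta>_hom] that objD F.omap_in_Obj by blast
  \<comment> \<open>The second half of (ii), where the other premises are met by
    \<open>z = omap G y\<close> and \<open>f = \<psi> y\<close>.\<close>
  have extend: "\<exists>!k. k \<in> Hom E y w \<and> k \<odot>\<^bsub>C\<^esub> \<psi> y = g"
    if "y \<in> Obj E" "w \<in> Obj E" "g \<in> Hom C (omap G y) w" for y w g
    using ii[OF _ that(1,2) \<psi>_hom that(3)] that objE G.omap_in_Obj by blast
  \<comment> \<open>Four cancellation laws follow, each the uniqueness half of one of the four
    universal properties. They cancel only between arrows of \<open>E\<close> (on the left of a
    composite) or of \<open>D\<close> (on the right), not between arbitrary arrows of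
    \<open>C\<close>.\<close>
  have epi_\<eta>: "a = b"
    if "x \<in> Obj C" "a \<in> Hom E (omap F x) y" "b \<in> Hom E (omap F x) y"
      "a \<odot>\<^bsub>C\<^esub> \<eta> x = b \<odot>\<^bsub>C\<^esub> \<eta> x" for x y a b
  proof -
    have "y \<in> Obj E" using HomD[OF E.sub.category_axioms that(2)] by blast
    with reflect[OF that(1) this C.Comp_in_Hom[OF \<eta>_hom homE]] that show ?thesis by metis
  qed
  have epi_\<psi>: "a = b"
    if "y \<in> Obj E" "a \<in> Hom E y w" "b \<in> Hom E y w"
      "a \<odot>\<^bsub>C\<^esub> \<psi> y = b \<odot>\<^bsub>C\<^esub> \<psi> y" for y w a b
  proof -
    have "w \<in> Obj E" using HomD[OF E.sub.category_axioms that(2)] by blast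
    with extend[OF that(1) this C.Comp_in_Hom[OF \<psi>_hom homE]] that objE show ?thesis by metis
  qed
  have mono_\<psi>: "a = b"
    if "x \<in> Obj C" "a \<in> Hom D z (omap G x)" "b \<in> Hom D z (omap G x)"
      "\<psi> x \<odot>\<^bsub>C\<^esub> a = \<psi> x \<odot>\<^bsub>C\<^esub> b" for x z a b
  proof -
    have "z \<in> Obj D" using HomD[OF D.sub.category_axioms that(2)] by blast
    with coreflect[OF that(1) this C.Comp_in_Hom[OF homD \<psi>_hom]] that show ?thesis by metis
  qed
  have mono_\<eta>: "a = b"
    if "x \<in> Obj D" "a \<in> Hom D z x" "b \<in> Hom D z x"
      "\<eta> x \<odot>\<^bsub>C\<^esub> a = \<eta> x \<odot>\<^bsub>C\<^esub> b" for x z a b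
  proof -
    have "z \<in> Obj D" using HomD[OF D.sub.category_axioms that(2)] by blast
    with lift[OF this that(1) C.Comp_in_Hom[OF homD \<eta>_hom]] that objD show ?thesis by metis
  qed

  \<comment> \<open>Restriction to a subcategory is expressed as precomposition with the
    inclusion.\<close>
  have FD: "is_functor D E (F \<circ>\<^sub>F incl)" using inclD F by (rule is_functor_comp)
  have GE: "is_functor E D (G \<circ>\<^sub>F incl)" using inclE G by (rule is_functor_comp)

  have "nat_isomorphic E E ((F \<circ>\<^sub>F incl) \<circ>\<^sub>F (G \<circ>\<^sub>F incl)) id_func"
  proof -
    \<comment> \<open>The factorization of \<open>\<psi> y\<close> through the reflection of
      \<open>omap G y\<close>. The definite description turns these arrows into one family indexed
      by \<open>y\<close>, pointing from FG to the identity.\<close>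
    define k where
      "k y = (THE k. k \<in> Hom E (omap F (omap G y)) y \<and> k \<odot>\<^bsub>C\<^esub> \<eta> (omap G y) = \<psi> y)" for y
    have k: "k y \<in> Hom E (omap F (omap G y)) y" "k y \<odot>\<^bsub>C\<^esub> \<eta> (omap G y) = \<psi> y"
      if "y \<in> Obj E" for y
      using theI'[OF reflect[OF objD[OF G.omap_in_Obj] that \<psi>_hom]] that objE
      by (simp_all add: k_def)
    show ?thesis
    proof (rule nat_isomorphicI[where \<tau> = k])
      fix y assume "y \<in> Obj E"
      let ?x = "omap G y"
      have y: "y \<in> Obj C" "?x \<in> Obj D" "?x \<in> Obj C" "omap F ?x \<in> Obj E"
        using \<open>y \<in> Obj E\<close> objD objE F.omap_in_Obj G.omap_in_Obj by blast+
      \<comment> \<open>The candidate inverse extends \<eta> at G y along \<open>\<psi> y\<close>;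
        this is where (ii) enters.\<close>
      obtain m where m: "m \<in> Hom E y (omap F ?x)" "m \<odot>\<^bsub>C\<^esub> \<psi> y = \<eta> ?x"
        using extend[OF \<open>y \<in> Obj E\<close> y(4) \<eta>_hom[OF y(3)]] by blast
      note hom = k(1)[OF \<open>y \<in> Obj E\<close>] m(1)
      \<comment> \<open>Both sides agree after precomposition with \<eta> at G y, since m k \<eta> =
        m \<psi> = \<eta>. The composite is first moved from \<open>E\<close> to \<open>C\<close>,
        because \<eta> need not be an arrow of \<open>E\<close>.\<close>
      have "m \<odot>\<^bsub>E\<^esub> k y = Ide E (omap F ?x)"
      proof (rule epi_\<eta>[OF y(3)])
        have "(m \<odot>\<^bsub>E\<^esub> k y) \<odot>\<^bsub>C\<^esub> \<eta> ?x = m \<odot>\<^bsub>C\<^esub> (k y \<odot>\<^bsub>C\<^esub> \<eta> ?x)"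
          using hom y by (simp add: E.Comp_eq C.Comp_assoc[OF \<eta>_hom homE homE])
        also have "\<dots> = Ide E (omap F ?x) \<odot>\<^bsub>C\<^esub> \<eta> ?x"
          using \<open>y \<in> Obj E\<close> y by (simp add: k m E.Ide_eq C.Comp_Ide_left[OF \<eta>_hom])
        finally show "(m \<odot>\<^bsub>E\<^esub> k y) \<odot>\<^bsub>C\<^esub> \<eta> ?x = Ide E (omap F ?x) \<odot>\<^bsub>C\<^esub> \<eta> ?x" .
      qed (use hom y E.sub.Ide_in_Hom E.sub.Comp_in_Hom in blast)+
      \<comment> \<open>Here \<open>\<psi> y\<close> is cancelled instead: k m \<psi> = k \<eta> =
        \<psi>.\<close>
      moreover have "k y \<odot>\<^bsub>E\<^esub> m = Ide E y"
      proof (rule epi_\<psi>[OF \<open>y \<in> Obj E\<close>])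
        have "(k y \<odot>\<^bsub>E\<^esub> m) \<odot>\<^bsub>C\<^esub> \<psi> y = k y \<odot>\<^bsub>C\<^esub> (m \<odot>\<^bsub>C\<^esub> \<psi> y)"
          using hom y by (simp add: E.Comp_eq C.Comp_assoc[OF \<psi>_hom homE homE])
        also have "\<dots> = Ide E y \<odot>\<^bsub>C\<^esub> \<psi> y"
          using \<open>y \<in> Obj E\<close> y by (simp add: k m E.Ide_eq C.Comp_Ide_left[OF \<psi>_hom])
        finally show "(k y \<odot>\<^bsub>E\<^esub> m) \<odot>\<^bsub>C\<^esub> \<psi> y = Ide E y \<odot>\<^bsub>C\<^esub> \<psi> y" .
      qed (use hom \<open>y \<in> Obj E\<close> E.sub.Ide_in_Hom E.sub.Comp_in_Hom in blast)+
      ultimately show "iso_arrow E (omap ((F \<circ>\<^sub>F incl) \<circ>\<^sub>F (G \<circ>\<^sub>F incl)) y) (omap id_func y) (k y)"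
        using hom by (auto simp: iso_arrow_def)
    next
      fix e y z assume e: "e \<in> Hom E y z"
      let ?Ge = "amap G e"
      have yz: "y \<in> Obj E" "z \<in> Obj E" using HomD[OF E.sub.category_axioms e] .
      then have obj: "y \<in> Obj C" "omap G y \<in> Obj C" "omap G z \<in> Obj C"
        using objD objE G.omap_in_Obj by blast+
      have Ge: "?Ge \<in> Hom C (omap G y) (omap G z)" using e homD homE G.amap_in_Hom by blast
      have FGe: "amap F ?Ge \<in> Hom E (omap F (omap G y)) (omap F (omap G z))"
        using Ge by (rule F.amap_in_Hom)
      \<comment> \<open>Precomposed with \<eta> at G y, both sides become \<open>e\<close> after
        \<open>\<psi> y\<close>: naturality of \<eta> at \<open>?Ge\<close> turns the left side into
        \<open>\<psi> z\<close> after \<open>?Ge\<close>, and naturality of \<psi> at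
        \<open>e\<close> does the rest.\<close>
      have "k z \<odot>\<^bsub>E\<^esub> amap F ?Ge = e \<odot>\<^bsub>E\<^esub> k y"
      proof (rule epi_\<eta>[OF obj(2)])
        have "(k z \<odot>\<^bsub>E\<^esub> amap F ?Ge) \<odot>\<^bsub>C\<^esub> \<eta> (omap G y)
            = k z \<odot>\<^bsub>C\<^esub> (amap F ?Ge \<odot>\<^bsub>C\<^esub> \<eta> (omap G y))"
          using E.Comp_eq[OF FGe k(1)] C.Comp_assoc[OF \<eta>_hom homE[OF FGe] homE[OF k(1)]] yz obj
          by simp
        also have "\<dots> = (k z \<odot>\<^bsub>C\<^esub> \<eta> (omap G z)) \<odot>\<^bsub>C\<^esub> ?Ge"
          using C.Comp_assoc[OF Ge \<eta>_hom homE[OF k(1)]] yz obj \<eta>_nat[OF Ge] by simp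
        also have "\<dots> = e \<odot>\<^bsub>C\<^esub> (k y \<odot>\<^bsub>C\<^esub> \<eta> (omap G y))"
          using yz \<psi>_nat[OF homE[OF e]] by (simp add: k)
        also have "\<dots> = (e \<odot>\<^bsub>E\<^esub> k y) \<odot>\<^bsub>C\<^esub> \<eta> (omap G y)"
          using E.Comp_eq[OF k(1) e] C.Comp_assoc[OF \<eta>_hom homE[OF k(1)] homE[OF e]] yz obj
          by simp
        finally show "(k z \<odot>\<^bsub>E\<^esub> amap F ?Ge) \<odot>\<^bsub>C\<^esub> \<eta> (omap G y)
            = (e \<odot>\<^bsub>E\<^esub> k y) \<odot>\<^bsub>C\<^esub> \<eta> (omap G y)" .
      qed (use FGe k(1) e yz E.sub.Comp_in_Hom in blast)+
      then show "k z \<odot>\<^bsub>E\<^esub> amap ((F \<circ>\<^sub>F incl) \<circ>\<^sub>F (G \<circ>\<^sub>F incl)) e = amap id_func e \<odot>\<^bsub>E\<^esub> k y"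
        by simp
    qed (use FD GE is_functor_comp is_functor_id_func E.sub.category_axioms in blast)+
  qed
  moreover have "nat_isomorphic D D ((G \<circ>\<^sub>F incl) \<circ>\<^sub>F (F \<circ>\<^sub>F incl)) id_func"
  proof -
    \<comment> \<open>By (i), \<psi> at F x lifts through \<open>\<eta> x\<close> to an arrow of
      \<open>D\<close>, although \<open>\<eta> x\<close> itself need not lie in
      \<open>D\<close>.\<close>
    define n where
      "n x = (THE n. n \<in> Hom D (omap G (omap F x)) x \<and> \<eta> x \<odot>\<^bsub>C\<^esub> n = \<psi> (omap F x))" for x
    have n: "n x \<in> Hom D (omap G (omap F x)) x" "\<eta> x \<odot>\<^bsub>C\<^esub> n x = \<psi> (omap F x)"
      if "x \<in> Obj D" for x
      using theI'[OF lift[OF G.omap_in_Obj that \<psi>_hom]] that objD objE F.omap_in_Obj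
      by (simp_all add: n_def)
    show ?thesis
    proof (rule nat_isomorphicI[where \<tau> = n])
      fix x assume "x \<in> Obj D"
      let ?y = "omap F x"
      have x: "x \<in> Obj C" "?y \<in> Obj E" "?y \<in> Obj C" "omap G ?y \<in> Obj D"
        using \<open>x \<in> Obj D\<close> objD objE F.omap_in_Obj G.omap_in_Obj by blast+
      \<comment> \<open>The inverse comes from the coreflection alone, as the factorization of
        \<open>\<eta> x\<close> through \<psi> at F x.\<close>
      obtain h where h: "h \<in> Hom D x (omap G ?y)" "\<psi> ?y \<odot>\<^bsub>C\<^esub> h = \<eta> x"
        using coreflect[OF x(3) \<open>x \<in> Obj D\<close> \<eta>_hom[OF x(1)]] by blast
      note hom = n(1)[OF \<open>x \<in> Obj D\<close>] h(1)
      \<comment> \<open>Cancelling \<psi> at F x on the left: \<psi> h n = \<eta> n =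
        \<psi>.\<close>
      have "h \<odot>\<^bsub>D\<^esub> n x = Ide D (omap G ?y)"
      proof (rule mono_\<psi>[OF x(3)])
        have "\<psi> ?y \<odot>\<^bsub>C\<^esub> (h \<odot>\<^bsub>D\<^esub> n x) = (\<psi> ?y \<odot>\<^bsub>C\<^esub> h) \<odot>\<^bsub>C\<^esub> n x"
          using hom x by (simp add: D.Comp_eq C.Comp_assoc[OF homD homD \<psi>_hom])
        also have "\<dots> = \<psi> ?y \<odot>\<^bsub>C\<^esub> Ide D (omap G ?y)"
          using \<open>x \<in> Obj D\<close> x by (simp add: n h D.Ide_eq C.Comp_Ide_right[OF \<psi>_hom])
        finally show "\<psi> ?y \<odot>\<^bsub>C\<^esub> (h \<odot>\<^bsub>D\<^esub> n x) = \<psi> ?y \<odot>\<^bsub>C\<^esub> Ide D (omap G ?y)" .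
      qed (use hom x D.sub.Ide_in_Hom D.sub.Comp_in_Hom in blast)+
      \<comment> \<open>Cancelling \<open>\<eta> x\<close> on the left: \<eta> n h = \<psi> h =
        \<eta>.\<close>
      moreover have "n x \<odot>\<^bsub>D\<^esub> h = Ide D x"
      proof (rule mono_\<eta>[OF \<open>x \<in> Obj D\<close>])
        have "\<eta> x \<odot>\<^bsub>C\<^esub> (n x \<odot>\<^bsub>D\<^esub> h) = (\<eta> x \<odot>\<^bsub>C\<^esub> n x) \<odot>\<^bsub>C\<^esub> h"
          using hom x by (simp add: D.Comp_eq C.Comp_assoc[OF homD homD \<eta>_hom])
        also have "\<dots> = \<eta> x \<odot>\<^bsub>C\<^esub> Ide D x"
          using \<open>x \<in> Obj D\<close> x by (simp add: n h D.Ide_eq C.Comp_Ide_right[OF \<eta>_hom])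
        finally show "\<eta> x \<odot>\<^bsub>C\<^esub> (n x \<odot>\<^bsub>D\<^esub> h) = \<eta> x \<odot>\<^bsub>C\<^esub> Ide D x" .
      qed (use hom \<open>x \<in> Obj D\<close> D.sub.Ide_in_Hom D.sub.Comp_in_Hom in blast)+
      ultimately show "iso_arrow D (omap ((G \<circ>\<^sub>F incl) \<circ>\<^sub>F (F \<circ>\<^sub>F incl)) x) (omap id_func x) (n x)"
        using hom by (auto simp: iso_arrow_def)
    next
      fix d x z assume d: "d \<in> Hom D x z"
      let ?Fd = "amap F d"
      have xz: "x \<in> Obj D" "z \<in> Obj D" using HomD[OF D.sub.category_axioms d] .
      then have obj: "x \<in> Obj C" "z \<in> Obj C" "omap F x \<in> Obj C" "omap F z \<in> Obj C"
        using objD objE F.omap_in_Obj by blast+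
      have Fd: "?Fd \<in> Hom C (omap F x) (omap F z)" using d homD homE F.amap_in_Hom by blast
      have GFd: "amap G ?Fd \<in> Hom D (omap G (omap F x)) (omap G (omap F z))"
        using Fd by (rule G.amap_in_Hom)
      \<comment> \<open>After \<open>\<eta> z\<close> is composed on the left, naturality of \<psi>
        is used at \<open>?Fd\<close> and that of \<eta> at \<open>d\<close>; both sides equal
        \<open>?Fd\<close> after \<psi> at F x.\<close>
      have "n z \<odot>\<^bsub>D\<^esub> amap G ?Fd = d \<odot>\<^bsub>D\<^esub> n x"
      proof (rule mono_\<eta>[OF xz(2)])
        have "\<eta> z \<odot>\<^bsub>C\<^esub> (n z \<odot>\<^bsub>D\<^esub> amap G ?Fd) = (\<eta> z \<odot>\<^bsub>C\<^esub> n z) \<odot>\<^bsub>C\<^esub> amap G ?Fd"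
          using D.Comp_eq[OF GFd n(1)] C.Comp_assoc[OF homD[OF GFd] homD[OF n(1)] \<eta>_hom] xz obj
          by simp
        also have "\<dots> = ?Fd \<odot>\<^bsub>C\<^esub> (\<eta> x \<odot>\<^bsub>C\<^esub> n x)"
          using xz \<psi>_nat[OF Fd] by (simp add: n)
        also have "\<dots> = (\<eta> z \<odot>\<^bsub>C\<^esub> d) \<odot>\<^bsub>C\<^esub> n x"
          using C.Comp_assoc[OF homD[OF n(1)] \<eta>_hom Fd] xz obj \<eta>_nat[OF homD[OF d]] by simp
        also have "\<dots> = \<eta> z \<odot>\<^bsub>C\<^esub> (d \<odot>\<^bsub>D\<^esub> n x)"
          using D.Comp_eq[OF n(1) d] C.Comp_assoc[OF homD[OF n(1)] homD[OF d] \<eta>_hom] xz obj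
          by simp
        finally show "\<eta> z \<odot>\<^bsub>C\<^esub> (n z \<odot>\<^bsub>D\<^esub> amap G ?Fd) = \<eta> z \<odot>\<^bsub>C\<^esub> (d \<odot>\<^bsub>D\<^esub> n x)" .
      qed (use GFd n(1) d xz D.sub.Comp_in_Hom in blast)+
      then show "n z \<odot>\<^bsub>D\<^esub> amap ((G \<circ>\<^sub>F incl) \<circ>\<^sub>F (F \<circ>\<^sub>F incl)) d = amap id_func d \<odot>\<^bsub>D\<^esub> n x"
        by simp
    qed (use FD GE is_functor_comp is_functor_id_func D.sub.category_axioms in blast)+
  qed
  ultimately show ?thesis using FD GE by (simp add: quasi_inverse_def)
qed

end
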